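(* In single-key MagnifierSketch, the expectation of the amortized time complexity to insert an arbitrary item $e=(k,v)$ is at most $O\!\left(\frac{s}{r}\right)$.
   Context: Let $w\in(0,1)$ be a fixed target quantile and $r,s$ positive even integers. Single-key MagnifierSketch processes a stream of items (values $v$; keys ignored) and maintains two multisets, the Candidate $C$ (capacity $r$) and the Representative $R$ (capacity $s$), both initially empty. Basic insertion of an element $x$ (a real number or $\pm\infty$): add $x$ to $C$; if now $|C|=r$, compute the $(r/2)$-th and $(r/2+1)$-th smallest elements $v',v''$ of $C$, empty $C$, and add $v',v''$ to $R$; if now $|R|>s$, find and remove one maximum and one minimum element of $R$. Inserting an item with value $v$ (Distribution Calibration): if $w>1/2$ draw $Z$ geometric on $\{1,2,\dots\}$ with success probability $1/(2w)$ and basic-insert $Z-1$ copies of $+\infty$ followed by $v$; if $w<1/2$ draw $Z$ geometric with success probability $1/(2-2w)$ and basic-insert $Z-1$ copies of $-\infty$ followed by $v$; if $w=1/2$ basic-insert $v$ only. Time is measured in the standard word-RAM model, with the expectation taken over the random draws of $Z$.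
   Formalization: The bound O(s/r) is stated as O(max(1, s/r)): every insertion takes at least one step, so O(s/r) fails when s/r tends to 0 (e.g. s = 2 and r large); for s at least a constant multiple of r the two bounds agree. *)

theory Defs
  imports "HOL-Probability.Probability" "HOL-Library.Multiset"
begin

section \<open>The sketch as an abstract process\<close>

text \<open>Pairs of Candidate and Representative; the keys of items play no role.\<close>

type_synonym sketch = "ereal multiset \<times> ereal multiset"

definition kth_smallest :: "nat \<Rightarrow> ereal multiset \<Rightarrow> ereal" where
  "kth_smallest k M = sorted_list_of_multiset M ! (k - 1)"

definition basic_insert :: "nat \<Rightarrow> nat \<Rightarrow> ereal \<Rightarrow> sketch \<Rightarrow> sketch" where
  "basic_insert r s x = (\<lambda>(C, R).
     let C' = add_mset x C in
     if size C' = r then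
       let R' = R + {#kth_smallest (r div 2) C', kth_smallest (r div 2 + 1) C'#} in
       ({#}, if size R' > s then R' - {#Max_mset R'#} - {#Min_mset R'#} else R')
     else (C', R))"

definition draws :: "real \<Rightarrow> nat pmf" where
  "draws w =
     (if w > 1 / 2 then map_pmf Suc (geometric_pmf (1 / (2 * w)))
      else if w < 1 / 2 then map_pmf Suc (geometric_pmf (1 / (2 - 2 * w)))
      else return_pmf 1)"
  \<comment> \<open>the law of \<open>Z\<close>; \<open>geometric_pmf\<close> counts failures and so starts at \<open>0\<close>\<close>

definition padding :: "real \<Rightarrow> ereal" where
  "padding w = (if w > 1 / 2 then \<infinity> else - \<infinity>)"

definition insert_item :: "real \<Rightarrow> nat \<Rightarrow> nat \<Rightarrow> 'k \<times> real \<Rightarrow> sketch \<Rightarrow> sketch pmf" where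
  "insert_item w r s e S =
     map_pmf (\<lambda>z. basic_insert r s (ereal (snd e)) ((basic_insert r s (padding w) ^^ (z - 1)) S))
       (draws w)"

primrec insert_stream :: "real \<Rightarrow> nat \<Rightarrow> nat \<Rightarrow> ('k \<times> real) list \<Rightarrow> sketch \<Rightarrow> sketch pmf" where
  "insert_stream w r s [] S = return_pmf S"
| "insert_stream w r s (e # es) S = bind_pmf (insert_item w r s e S) (insert_stream w r s es)"


section \<open>Computations with a running time\<close>

text \<open>
  Time is counted as follows. Each call of one of the procedures below, recursive calls included,
  costs one unit, charged by \<open>tick\<close>. Apart from such calls, a procedure body only performs a
  constant number of word-RAM steps: comparisons and arithmetic on words, and building or
  inspecting a bounded number of list cells.
\<close>

datatype 'a timed = Timed (result: 'a) (cost: nat)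

definition ret :: "'a \<Rightarrow> 'a timed" where
  "ret x = Timed x 0"

definition bind_timed :: "'a timed \<Rightarrow> ('a \<Rightarrow> 'b timed) \<Rightarrow> 'b timed" where
  "bind_timed m f = Timed (result (f (result m))) (cost m + cost (f (result m)))"

adhoc_overloading Monad_Syntax.bind \<rightleftharpoons> bind_timed

definition charge :: "nat \<Rightarrow> unit timed" where
  "charge n = Timed () n"

definition tick :: "'a timed \<Rightarrow> 'a timed" where
  "tick m = Timed (result m) (Suc (cost m))"

lemma result_simps [simp]:
  "result (ret x) = x"
  "result (bind_timed m f) = result (f (result m))"
  "result (tick m) = result m"
  by (simp_all add: ret_def bind_timed_def tick_def)

lemma cost_simps [simp]:
  "cost (ret x) = 0"
  "cost (bind_timed m f) = cost m + cost (f (result m))"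
  "cost (tick m) = Suc (cost m)"
  "cost (charge n) = n"
  by (simp_all add: ret_def bind_timed_def tick_def charge_def)

lemma bind_timed_cong [fundef_cong]:
  assumes "m = m'" and "\<And>x. result m' = x \<Longrightarrow> f x = g x"
  shows "bind_timed m f = bind_timed m' g"
  using assms by (simp add: bind_timed_def)


section \<open>Selection in worst-case linear time\<close>

primrec length_t :: "'a list \<Rightarrow> nat timed" where
  "length_t [] = tick (ret 0)"
| "length_t (x # xs) = tick (do { n \<leftarrow> length_t xs; ret (Suc n) })"

fun nth_t :: "'a list \<Rightarrow> nat \<Rightarrow> 'a timed" where
  "nth_t [] i = tick (ret undefined)"
| "nth_t (x # xs) i = tick (if i = 0 then ret x else nth_t xs (i - 1))"

primrec insort_t :: "'a::linorder \<Rightarrow> 'a list \<Rightarrow> 'a list timed" where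
  "insort_t x [] = tick (ret [x])"
| "insort_t x (y # ys) = tick (
     if x \<le> y then ret (x # y # ys)
     else do { zs \<leftarrow> insort_t x ys; ret (y # zs) })"

primrec sort_t :: "'a::linorder list \<Rightarrow> 'a list timed" where
  "sort_t [] = tick (ret [])"
| "sort_t (x # xs) = tick (do { ys \<leftarrow> sort_t xs; insort_t x ys })"

fun chop5_t :: "'a list \<Rightarrow> 'a list list timed" where
  "chop5_t (a # b # c # d # e # xs) = tick (do { yss \<leftarrow> chop5_t xs; ret ([a, b, c, d, e] # yss) })"
| "chop5_t [] = tick (ret [])"
| "chop5_t xs = tick (ret [xs])"

definition median_t :: "'a::linorder list \<Rightarrow> 'a timed" where
  "median_t xs = tick (do {
     n \<leftarrow> length_t xs;
     ys \<leftarrow> sort_t xs;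
     nth_t ys ((n - 1) div 2) })"

primrec medians_t :: "'a::linorder list list \<Rightarrow> 'a list timed" where
  "medians_t [] = tick (ret [])"
| "medians_t (xs # xss) = tick (do {
     m \<leftarrow> median_t xs;
     ms \<leftarrow> medians_t xss;
     ret (m # ms) })"

primrec partition3_t :: "'a::linorder \<Rightarrow> 'a list \<Rightarrow> ('a list \<times> 'a list \<times> 'a list) timed" where
  "partition3_t p [] = tick (ret ([], [], []))"
| "partition3_t p (x # xs) = tick (do {
     (ls, es, gs) \<leftarrow> partition3_t p xs;
     ret (if x < p then (x # ls, es, gs)
             else if x = p then (ls, x # es, gs)
             else (ls, es, x # gs)) })"

text \<open>Median of medians; ranks are counted from \<open>0\<close>.\<close>

function (domintros) select_t :: "nat \<Rightarrow> 'a::linorder list \<Rightarrow> 'a timed" where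
  "select_t k xs = tick (do {
     n \<leftarrow> length_t xs;
     if n \<le> 20 then do { ys \<leftarrow> sort_t xs; nth_t ys k }
     else do {
       xss \<leftarrow> chop5_t xs;
       ms \<leftarrow> medians_t xss;
       l \<leftarrow> length_t ms;
       p \<leftarrow> select_t ((l - 1) div 2) ms;
       (ls, es, gs) \<leftarrow> partition3_t p xs;
       nl \<leftarrow> length_t ls;
       ne \<leftarrow> length_t es;
       if k < nl then select_t k ls
       else if k < nl + ne then ret p
       else select_t (k - nl - ne) gs } })"
  by pat_completeness auto


lemma result_length_t [simp]: "result (length_t xs) = length xs"
  by (induction xs) auto

lemma result_nth_t [simp]: "i < length xs \<Longrightarrow> result (nth_t xs i) = xs ! i"
  by (induction xs i rule: nth_t.induct) auto

lemma result_insort_t [simp]: "result (insort_t x xs) = insort x xs"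
  by (induction xs) auto

lemma result_sort_t [simp]: "result (sort_t xs) = sort xs"
  by (induction xs) auto

lemma concat_chop5_t: "concat (result (chop5_t xs)) = xs"
  by (induction xs rule: chop5_t.induct) auto

lemma Nil_notin_chop5_t: "[] \<notin> set (result (chop5_t xs))"
  by (induction xs rule: chop5_t.induct) auto

lemma length_chop5_t: "length (result (chop5_t xs)) = (length xs + 4) div 5"
  by (induction xs rule: chop5_t.induct) auto

lemma result_median_t: "xs \<noteq> [] \<Longrightarrow> result (median_t xs) = sort xs ! ((length xs - 1) div 2)"
  unfolding median_t_def by (cases xs) auto

lemma median_t_in_set: "xs \<noteq> [] \<Longrightarrow> result (median_t xs) \<in> set xs"
proof -
  assume "xs \<noteq> []"
  then have "(length xs - 1) div 2 < length (sort xs)"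
    by (cases xs) auto
  from nth_mem[OF this] show ?thesis
    using \<open>xs \<noteq> []\<close> by (simp add: result_median_t)
qed

lemma result_medians_t: "result (medians_t xss) = map (\<lambda>xs. result (median_t xs)) xss"
  by (induction xss) auto

lemma set_medians_t: "set (result (medians_t (result (chop5_t xs)))) \<subseteq> set xs"
proof
  fix m assume "m \<in> set (result (medians_t (result (chop5_t xs))))"
  then obtain ys where ys: "ys \<in> set (result (chop5_t xs))" "m = result (median_t ys)"
    by (auto simp: result_medians_t)
  with Nil_notin_chop5_t[of xs] have "m \<in> set ys"
    using median_t_in_set[of ys] by auto
  with ys(1) have "m \<in> set (concat (result (chop5_t xs)))"
    by auto
  then show "m \<in> set xs"
    by (simp only: concat_chop5_t)
qed

lemma result_partition3_t:
  "result (partition3_t p xs) =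
     (filter (\<lambda>x. x < p) xs, filter (\<lambda>x. x = p) xs, filter (\<lambda>x. p < x) xs)"
  by (induction xs) auto

lemma select_t_dom:
  "select_t_dom (k, xs) \<and> (k < length xs \<longrightarrow> result (select_t k xs) = sort xs ! k)"
proof (induction "length xs" arbitrary: k xs rule: less_induct)
  case less
  define ms where "ms = result (medians_t (result (chop5_t xs)))"
  define j where "j = (length ms - 1) div 2"
  define p where "p = result (select_t j ms)"
  define ls where "ls = filter (\<lambda>x. x < p) xs"
  define es where "es = filter (\<lambda>x. x = p) xs"
  define gs where "gs = filter (\<lambda>x. p < x) xs"
  have len_ms: "length ms = (length xs + 4) div 5"
    by (simp add: ms_def result_medians_t length_chop5_t)
  have ms_dom: "select_t_dom (j, ms)" and p_in: "p \<in> set xs" if "\<not> length xs \<le> 20"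
  proof -
    have "length ms < length xs" "j < length ms"
      using that len_ms unfolding j_def by auto
    with less[of ms j] have *: "select_t_dom (j, ms)" "p = sort ms ! j"
      unfolding p_def by auto
    from *(1) show "select_t_dom (j, ms)" .
    have "p \<in> set ms"
      using *(2) \<open>j < length ms\<close> nth_mem[of j "sort ms"] by simp
    then show "p \<in> set xs"
      using set_medians_t[of xs] by (auto simp: ms_def)
  qed
  have lens: "length ls < length xs" "length gs < length xs" if "\<not> length xs \<le> 20"
    using p_in[OF that] unfolding ls_def gs_def by (auto intro!: length_filter_less)
  have dom: "select_t_dom (k, xs)"
  proof (rule select_t.domintros, goal_cases)
    case 1
    then show ?case
      using ms_dom by (simp add: ms_def j_def)
  next
    case (2 a b c)
    then have "a = ls"
      by (simp add: result_partition3_t ls_def p_def ms_def j_def)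
    then show ?case
      using less[of ls k] lens 2 by simp
  next
    case (3 a b c)
    then have "c = gs"
      by (simp add: result_partition3_t gs_def p_def ms_def j_def)
    then show ?case
      using less[of gs] lens 3 by simp
  qed
  have sort_xs: "sort xs = sort ls @ es @ sort gs"
  proof (rule properties_for_sort)
    show "mset (sort ls @ es @ sort gs) = mset xs"
      unfolding ls_def es_def gs_def by (induction xs) auto
    have "sorted es"
      unfolding es_def by (induction xs) auto
    then show "sorted (sort ls @ es @ sort gs)"
      by (auto simp: sorted_append ls_def es_def gs_def)
  qed
  have eq_es: "es ! i = p" if "i < length es" for i
    using nth_mem[OF that] by (simp add: es_def)
  have len: "length xs = length ls + length es + length gs"
    using arg_cong[OF sort_xs, of length] by simp
  have "result (select_t k xs) = sort xs ! k" if k: "k < length xs"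
  proof (cases "length xs \<le> 20")
    case True
    then show ?thesis
      using k by (simp add: select_t.psimps[OF dom])
  next
    case False
    have "result (select_t k xs) =
       (if k < length ls then result (select_t k ls)
        else if k < length ls + length es then p
        else result (select_t (k - length ls - length es) gs))"
      using False
      by (simp add: select_t.psimps[OF dom] result_partition3_t ls_def es_def gs_def
          p_def ms_def j_def)
    moreover have "result (select_t k ls) = sort ls ! k" if "k < length ls"
      using less[of ls k] lens(1)[OF False] that by simp
    moreover have "result (select_t (k - length ls - length es) gs)
        = sort gs ! (k - length ls - length es)" if "\<not> k < length ls + length es"
      using less[of gs "k - length ls - length es"] lens(2)[OF False] that k len by simp
    ultimately show ?thesis
      using eq_es by (auto simp: sort_xs nth_append)
  qed
  with dom show ?case
    by blast
qed

termination select_t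
  using select_t_dom by auto

declare select_t.simps [simp del]

lemma result_select_t: "k < length xs \<Longrightarrow> result (select_t k xs) = sort xs ! k"
  using select_t_dom by blast


section \<open>The implementation\<close>

primrec drop_max_t :: "'a::linorder \<Rightarrow> 'a list \<Rightarrow> 'a list timed" where
  "drop_max_t m [] = tick (ret [])"
| "drop_max_t m (x # xs) = tick (
     if m < x then do { ys \<leftarrow> drop_max_t x xs; ret (m # ys) }
     else do { ys \<leftarrow> drop_max_t m xs; ret (x # ys) })"

primrec drop_min_t :: "'a::linorder \<Rightarrow> 'a list \<Rightarrow> 'a list timed" where
  "drop_min_t m [] = tick (ret [])"
| "drop_min_t m (x # xs) = tick (
     if x < m then do { ys \<leftarrow> drop_min_t x xs; ret (m # ys) }
     else do { ys \<leftarrow> drop_min_t m xs; ret (x # ys) })"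

fun remove_max_t :: "'a::linorder list \<Rightarrow> 'a list timed" where
  "remove_max_t [] = tick (ret [])"
| "remove_max_t (x # xs) = tick (drop_max_t x xs)"

fun remove_min_t :: "'a::linorder list \<Rightarrow> 'a list timed" where
  "remove_min_t [] = tick (ret [])"
| "remove_min_t (x # xs) = tick (drop_min_t x xs)"

text \<open>Candidate and Representative as lists, each followed by its length, so that the capacity
  tests take constant time.\<close>

type_synonym state = "ereal list \<times> nat \<times> ereal list \<times> nat"

definition empty_state :: state where
  "empty_state = ([], 0, [], 0)"

definition basic_insert_t :: "nat \<Rightarrow> nat \<Rightarrow> ereal \<Rightarrow> state \<Rightarrow> state timed" where
  "basic_insert_t r s x = (\<lambda>(C, n, R, l). tick (
     if n + 1 = r then do {
       v' \<leftarrow> select_t (r div 2 - 1) (x # C);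
       v'' \<leftarrow> select_t (r div 2) (x # C);
       if l + 2 > s then do {
         R' \<leftarrow> remove_max_t (v' # v'' # R);
         R'' \<leftarrow> remove_min_t R';
         ret ([], 0, R'', l) }
       else ret ([], 0, v' # v'' # R, l + 2) }
     else ret (x # C, n + 1, R, l)))"

primrec insert_copies_t :: "nat \<Rightarrow> nat \<Rightarrow> ereal \<Rightarrow> nat \<Rightarrow> state \<Rightarrow> state timed" where
  "insert_copies_t r s x 0 S = tick (ret S)"
| "insert_copies_t r s x (Suc j) S = tick (do {
     S' \<leftarrow> basic_insert_t r s x S;
     insert_copies_t r s x j S' })"

text \<open>Drawing \<open>Z\<close> by repeated Bernoulli trials takes \<open>Z\<close> units.\<close>

definition insert_item_t :: "real \<Rightarrow> nat \<Rightarrow> nat \<Rightarrow> 'k \<times> real \<Rightarrow> state \<Rightarrow> state timed pmf" where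
  "insert_item_t w r s e S =
     map_pmf (\<lambda>z. tick (do {
         charge z;
         S' \<leftarrow> insert_copies_t r s (padding w) (z - 1) S;
         basic_insert_t r s (ereal (snd e)) S' }))
       (draws w)"

primrec insert_stream_t ::
  "real \<Rightarrow> nat \<Rightarrow> nat \<Rightarrow> ('k \<times> real) list \<Rightarrow> state \<Rightarrow> state timed pmf" where
  "insert_stream_t w r s [] S = return_pmf (ret S)"
| "insert_stream_t w r s (e # es) S =
     bind_pmf (insert_item_t w r s e S) (\<lambda>t.
       map_pmf (\<lambda>t'. bind_timed t (\<lambda>_. t')) (insert_stream_t w r s es (result t)))"


section \<open>The implementation computes the sketch\<close>

definition well_formed :: "state \<Rightarrow> bool" where
  "well_formed = (\<lambda>(C, n, R, l). n = length C \<and> l = length R)"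

definition abs_state :: "state \<Rightarrow> sketch" where
  "abs_state = (\<lambda>(C, n, R, l). (mset C, mset R))"

lemma well_formed_empty_state [simp]: "well_formed empty_state"
  by (simp add: well_formed_def empty_state_def)

lemma abs_state_empty_state [simp]: "abs_state empty_state = ({#}, {#})"
  by (simp add: abs_state_def empty_state_def)

lemma mset_drop_max_t:
  "mset (result (drop_max_t m xs)) = add_mset m (mset xs) - {#Max (insert m (set xs))#}"
proof (induction xs arbitrary: m)
  case (Cons x xs)
  have *: "Max (insert a (set xs)) \<in># add_mset a (mset xs)" for a
    using Max_in[of "insert a (set xs)"] by auto
  show ?case
  proof (cases "m < x")
    case True
    then have "Max (insert m (insert x (set xs))) = Max (insert x (set xs))"
      by (simp add: max_def)
         (metis List.finite_set Max_ge finite_insert insertI1 less_le_not_le order_trans)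
    then show ?thesis
      using True Cons diff_union_swap2[OF *[of x], of m] by (simp del: Max_insert Min_insert)
  next
    case False
    then have "Max (insert m (insert x (set xs))) = Max (insert m (set xs))"
      by (cases "xs = []") (auto simp: max_def)
    then show ?thesis
      using False Cons diff_union_swap2[OF *[of m], of x] by (simp add: add_mset_commute del: Max_insert Min_insert)
  qed
qed auto

lemma mset_drop_min_t:
  "mset (result (drop_min_t m xs)) = add_mset m (mset xs) - {#Min (insert m (set xs))#}"
proof (induction xs arbitrary: m)
  case (Cons x xs)
  have *: "Min (insert a (set xs)) \<in># add_mset a (mset xs)" for a
    using Min_in[of "insert a (set xs)"] by auto
  show ?case
  proof (cases "x < m")
    case True
    then have "Min (insert m (insert x (set xs))) = Min (insert x (set xs))"
      by (cases "xs = []") (auto simp: min_def)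
    then show ?thesis
      using True Cons diff_union_swap2[OF *[of x], of m] by (simp del: Max_insert Min_insert)
  next
    case False
    then have "Min (insert m (insert x (set xs))) = Min (insert m (set xs))"
      by (cases "xs = []") (auto simp: min_def)
    then show ?thesis
      using False Cons diff_union_swap2[OF *[of m], of x] by (simp add: add_mset_commute del: Max_insert Min_insert)
  qed
qed auto

lemma length_drop_max_t [simp]: "length (result (drop_max_t m xs)) = length xs"
  by (induction xs arbitrary: m) auto

lemma length_drop_min_t [simp]: "length (result (drop_min_t m xs)) = length xs"
  by (induction xs arbitrary: m) auto

lemma length_remove_max_t: "length (result (remove_max_t xs)) = length xs - 1"
  by (cases xs) auto

lemma length_remove_min_t: "length (result (remove_min_t xs)) = length xs - 1"
  by (cases xs) auto

lemma mset_remove_max_t: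
  "xs \<noteq> [] \<Longrightarrow> mset (result (remove_max_t xs)) = mset xs - {#Max (set xs)#}"
  by (cases xs) (auto simp: mset_drop_max_t)

lemma mset_remove_min_t:
  "xs \<noteq> [] \<Longrightarrow> mset (result (remove_min_t xs)) = mset xs - {#Min (set xs)#}"
  by (cases xs) (auto simp: mset_drop_min_t)

lemma remove_max_min_t:
  assumes "length xs \<ge> 2"
  shows "mset (result (remove_min_t (result (remove_max_t xs))))
           = mset xs - {#Max (set xs)#} - {#Min (set xs)#}"
proof -
  define ys where "ys = result (remove_max_t xs)"
  have ys: "mset ys = mset xs - {#Max (set xs)#}"
    unfolding ys_def using assms by (intro mset_remove_max_t) auto
  have ne: "ys \<noteq> []"
    using assms length_remove_max_t[of xs] by (auto simp: ys_def)
  have ins: "mset xs = add_mset (Max (set xs)) (mset ys)"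
  proof -
    have "Max (set xs) \<in># mset xs"
      using assms Max_in[of "set xs"] by (cases xs) auto
    then show ?thesis
      by (simp add: ys)
  qed
  then have "set xs = insert (Max (set xs)) (set ys)"
    by (metis set_mset_add_mset_insert set_mset_mset)
  moreover have "Min (set ys) \<le> Max (set xs)"
    using ne calculation by (metis List.finite_set Max_ge Min_in insertCI set_empty)
  ultimately have "Min (set xs) = Min (set ys)"
    using ne by (metis List.finite_set Min_insert min_def order_antisym set_empty)
  then show ?thesis
    using mset_remove_min_t[OF ne] by (simp add: ys flip: ys_def)
qed

lemma result_basic_insert_t:
  assumes "r > 0" "even r" "well_formed S"
  shows "well_formed (result (basic_insert_t r s x S))"
    and "abs_state (result (basic_insert_t r s x S)) = basic_insert r s x (abs_state S)"
proof -
  obtain C n R l where S: "S = (C, n, R, l)"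
    by (cases S)
  with assms have [simp]: "n = length C" "l = length R"
    by (auto simp: well_formed_def)
  define a where "a = result (select_t (r div 2 - 1) (x # C))"
  define b where "b = result (select_t (r div 2) (x # C))"
  have ab: "a = kth_smallest (r div 2) (mset (x # C))"
           "b = kth_smallest (r div 2 + 1) (mset (x # C))" if "Suc (length C) = r"
    using that assms(1) unfolding a_def b_def kth_smallest_def
    by (subst result_select_t; simp del: mset.simps)+
  have rem: "mset (result (remove_min_t (result (remove_max_t (a # b # R)))))
    = mset (a # b # R) - {#Max (set (a # b # R))#} - {#Min (set (a # b # R))#}"
    by (rule remove_max_min_t) simp
  have step: "result (basic_insert_t r s x S) =
    (if Suc (length C) = r then
       if s < length R + 2
       then ([], 0, result (remove_min_t (result (remove_max_t (a # b # R)))), length R)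
       else ([], 0, a # b # R, length R + 2)
     else (x # C, length C + 1, R, length R))"
    by (simp add: S basic_insert_t_def a_def b_def del: remove_max_t.simps remove_min_t.simps)
  show "well_formed (result (basic_insert_t r s x S))"
    by (simp add: step well_formed_def length_remove_max_t length_remove_min_t
        del: remove_max_t.simps remove_min_t.simps)
  have "mset R + {#a, b#} = mset (a # b # R)"
    by simp
  then show "abs_state (result (basic_insert_t r s x S)) = basic_insert r s x (abs_state S)"
    using ab[symmetric] rem unfolding step
    by (cases "Suc (length C) = r")
       (simp_all add: S abs_state_def basic_insert_def Let_def
        del: remove_max_t.simps remove_min_t.simps Max_insert Min_insert)
qed

lemma result_insert_copies_t:
  assumes "r > 0" "even r" "well_formed S"
  shows "well_formed (result (insert_copies_t r s x j S)) \<and>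
    abs_state (result (insert_copies_t r s x j S)) = (basic_insert r s x ^^ j) (abs_state S)"
  using assms(3)
  by (induction j arbitrary: S)
     (simp_all add: result_basic_insert_t[OF assms(1,2)] funpow_swap1)

lemma result_insert_item_t:
  assumes "r > 0" "even r" "well_formed S"
  shows "\<forall>t \<in> set_pmf (insert_item_t w r s e S). well_formed (result t)"
    and "map_pmf (\<lambda>t. abs_state (result t)) (insert_item_t w r s e S)
           = insert_item w r s e (abs_state S)"
  using result_insert_copies_t[OF assms] result_basic_insert_t[OF assms(1,2)]
  by (auto simp: insert_item_t_def insert_item_def map_pmf_comp)

theorem result_insert_stream_t:
  assumes "r > 0" "even r" "well_formed S"
  shows "map_pmf (\<lambda>t. abs_state (result t)) (insert_stream_t w r s es S)
           = insert_stream w r s es (abs_state S)"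
  using assms(3)
proof (induction es arbitrary: S)
  case (Cons e es)
  have "map_pmf (\<lambda>t. abs_state (result t)) (insert_stream_t w r s (e # es) S)
      = bind_pmf (insert_item_t w r s e S)
          (\<lambda>t. map_pmf (\<lambda>t. abs_state (result t)) (insert_stream_t w r s es (result t)))"
    by (simp add: map_bind_pmf map_pmf_comp)
  also have "\<dots> = bind_pmf (insert_item_t w r s e S)
          (\<lambda>t. insert_stream w r s es (abs_state (result t)))"
    using result_insert_item_t(1)[OF assms(1,2) Cons.prems]
    by (intro bind_pmf_cong refl Cons.IH) blast
  also have "\<dots> = insert_stream w r s (e # es) (abs_state S)"
    by (simp add: bind_map_pmf flip: result_insert_item_t(2)[OF assms(1,2) Cons.prems])
  finally show ?case .
qed simp


section \<open>Expected amortized time\<close>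

text \<open>
  The expected cost per item of inserting a stream into the empty sketch. Since it is at least
  \<open>1\<close> for all \<open>r\<close> and \<open>s\<close>, it can be \<open>O(s/r)\<close> only in the usual reading of a time bound, in which
  \<open>s / r\<close> stands for \<open>max 1 (s / r)\<close>.
\<close>

definition expected_amortized_time :: "real \<Rightarrow> nat \<Rightarrow> nat \<Rightarrow> ('k \<times> real) list \<Rightarrow> ennreal" where
  "expected_amortized_time w r s es =
     (\<integral>\<^sup>+ t. ennreal (real (cost t) / real (length es))
        \<partial>measure_pmf (insert_stream_t w r s es empty_state))"

lemma length_le_cost:
  "t \<in> set_pmf (insert_stream_t w r s es S) \<Longrightarrow> length es \<le> cost t"
proof (induction es arbitrary: S t)
  case (Cons e es)
  then obtain u t' where "u \<in> set_pmf (insert_item_t w r s e S)" "cost t = cost u + cost t'"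
    "t' \<in> set_pmf (insert_stream_t w r s es (result u))"
    by auto
  moreover from this(1) have "cost u \<ge> 1"
    by (auto simp: insert_item_t_def)
  ultimately show ?case
    using Cons.IH by fastforce
qed simp

lemma expected_amortized_time_ge_1:
  assumes "es \<noteq> []"
  shows "expected_amortized_time w r s es \<ge> 1"
proof -
  have "1 = (\<integral>\<^sup>+ t. 1 \<partial>measure_pmf (insert_stream_t w r s es empty_state))"
    by simp
  also have "\<dots> \<le> expected_amortized_time w r s es"
    unfolding expected_amortized_time_def
  proof (rule nn_integral_mono_AE, rule AE_pmfI)
    fix t assume "t \<in> set_pmf (insert_stream_t w r s es empty_state)"
    then have "real (cost t) / real (length es) \<ge> 1"
      using assms length_le_cost by (simp add: le_divide_eq)
    then show "1 \<le> ennreal (real (cost t) / real (length es))"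
      by simp
  qed
  finally show ?thesis .
qed

end

(* Median-of-medians selection costs O(r) on the full Candidate, and deleting a maximum and a
   minimum of the Representative costs O(s). This work of O(r + s) happens only once every r basic
   insertions, so giving each element of the Candidate a credit of order 1 + s/r pays for it. An
   item triggers Z basic insertions, and the mean of Z is 2 * max w (1 - w), which is less than 2. *)

theory Submission
  imports Defs
begin

section \<open>Costs of the elementary list procedures\<close>

lemma cost_length_t [simp]: "cost (length_t xs) = Suc (length xs)"
  by (induction xs) auto

lemma cost_nth_t_le: "cost (nth_t xs i) \<le> Suc (length xs)"
  by (induction xs i rule: nth_t.induct) auto

lemma cost_insort_t_le: "cost (insort_t x xs) \<le> Suc (length xs)"
  by (induction xs) auto

text \<open>Insertion at depth \<open>n\<close> costs at most \<open>n + 1\<close>, so a quadratic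
  bound results. This is good enough because selection sorts only lists of at most 20
  elements.\<close>

lemma cost_sort_t_le: "cost (sort_t xs) \<le> (Suc (length xs))\<^sup>2"
proof (induction xs)
  case (Cons x xs)
  then show ?case
    using cost_insort_t_le[of x "sort xs"] by (simp add: power2_eq_square)
qed simp

lemma cost_chop5_t: "cost (chop5_t xs) \<le> Suc (length xs)"
  by (induction xs rule: chop5_t.induct) auto

lemma length_in_chop5_t: "ys \<in> set (result (chop5_t xs)) \<Longrightarrow> length ys \<le> 5"
  by (induction xs rule: chop5_t.induct) auto

text \<open>For a group of five: 1 for the call, 6 for the length, 36 for sorting and 6 for the
  lookup.\<close>

lemma cost_median_t_le:
  assumes "length xs \<le> 5"
  shows "cost (median_t xs) \<le> 49"
proof -
  have "(Suc (length xs))\<^sup>2 \<le> 6\<^sup>2"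
    using assms by (intro power_mono) auto
  then show ?thesis
    using assms cost_sort_t_le[of xs] cost_nth_t_le[of "sort xs" "(length xs - 1) div 2"]
    by (simp add: median_t_def)
qed

lemma cost_medians_t_le:
  "(\<And>xs. xs \<in> set xss \<Longrightarrow> length xs \<le> 5) \<Longrightarrow> cost (medians_t xss) \<le> Suc (50 * length xss)"
proof (induction xss)
  case (Cons xs xss)
  then show ?case
    using cost_median_t_le[of xs] by fastforce
qed simp

lemma cost_partition3_t [simp]: "cost (partition3_t p xs) = Suc (length xs)"
  by (induction xs) (auto split: prod.split)

section \<open>The median-of-medians pivot and linear-time selection\<close>

lemma length_filter_sort: "length (filter P (sort xs)) = length (filter P xs)"
  by (metis mset_filter mset_sort size_mset)

text \<open>The entries at positions \<open>0\<close> to \<open>i\<close> of the sorted list are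
  bounded by the one at position \<open>i\<close>, hence by \<open>p\<close>.\<close>

lemma length_filter_le_nth_sort:
  assumes "i < length xs" "sort xs ! i \<le> p"
  shows "Suc i \<le> length (filter (\<lambda>x. x \<le> p) xs)"
proof -
  have "y \<le> p" if "y \<in> set (take (Suc i) (sort xs))" for y
  proof -
    from that obtain j where "j \<le> i" "y = sort xs ! j"
      using assms(1) by (auto simp: in_set_conv_nth less_Suc_eq_le)
    then show ?thesis
      using assms sorted_nth_mono[OF sorted_sort, of j i xs] by force
  qed
  then have "filter (\<lambda>x. x \<le> p) (take (Suc i) (sort xs)) = take (Suc i) (sort xs)"
    by (simp add: filter_id_conv)
  then have "length (filter (\<lambda>x. x \<le> p) (take (Suc i) (sort xs))) = Suc i"
    using assms(1) by simp
  moreover have "length (filter (\<lambda>x. x \<le> p) (sort xs)) =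
      length (filter (\<lambda>x. x \<le> p) (take (Suc i) (sort xs))) +
      length (filter (\<lambda>x. x \<le> p) (drop (Suc i) (sort xs)))"
    by (metis append_take_drop_id filter_append length_append)
  ultimately show ?thesis
    by (simp add: length_filter_sort)
qed

text \<open>Dually, the \<open>length xs - i\<close> entries from position \<open>i\<close> onwards
  all lie above \<open>p\<close>.\<close>

lemma length_filter_ge_nth_sort:
  assumes "i < length xs" "p \<le> sort xs ! i"
  shows "length xs - i \<le> length (filter (\<lambda>x. p \<le> x) xs)"
proof -
  have "p \<le> y" if "y \<in> set (drop i (sort xs))" for y
  proof -
    from that obtain j where "i + j < length xs" "y = sort xs ! (i + j)"
      using assms(1)
      by (metis add.commute in_set_conv_nth length_drop length_sort less_diff_conv less_imp_le nth_drop)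
    then show ?thesis
      using assms sorted_nth_mono[OF sorted_sort, of i "i + j" xs] by force
  qed
  then have "filter (\<lambda>x. p \<le> x) (drop i (sort xs)) = drop i (sort xs)"
    by (simp add: filter_id_conv)
  then have "length (filter (\<lambda>x. p \<le> x) (drop i (sort xs))) = length xs - i"
    by simp
  moreover have "length (filter (\<lambda>x. p \<le> x) (sort xs)) =
      length (filter (\<lambda>x. p \<le> x) (take i (sort xs))) +
      length (filter (\<lambda>x. p \<le> x) (drop i (sort xs)))"
    by (metis append_take_drop_id filter_append length_append)
  ultimately show ?thesis
    by (simp add: length_filter_sort)
qed

lemma median_t_le_count:
  assumes "xs \<noteq> []" "result (median_t xs) \<le> p"
  shows "(length xs + 1) div 2 \<le> length (filter (\<lambda>x. x \<le> p) xs)"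
proof -
  have "(length xs - 1) div 2 < length xs"
    using assms(1) by (cases xs) auto
  from length_filter_le_nth_sort[OF this, of p] assms show ?thesis
    by (cases xs) (auto simp: result_median_t)
qed

lemma median_t_ge_count:
  assumes "xs \<noteq> []" "p \<le> result (median_t xs)"
  shows "(length xs + 1) div 2 \<le> length (filter (\<lambda>x. p \<le> x) xs)"
proof -
  have "(length xs - 1) div 2 < length xs"
    using assms(1) by (cases xs) auto
  from length_filter_ge_nth_sort[OF this, of p] assms show ?thesis
    by (cases xs) (auto simp: result_median_t)
qed

text \<open>A group of five whose median satisfies \<open>P\<close> contributes at least three
  elements satisfying \<open>P\<close>. Only the last group can be shorter; it still contributes at
  least one, so the deficit is at most 2. The predicate is abstract so that one induction serves
  both sides of the pivot.\<close>

lemma medians_count: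
  assumes "\<And>ys. ys \<noteq> [] \<Longrightarrow> P (result (median_t ys)) \<Longrightarrow> (length ys + 1) div 2 \<le> length (filter P ys)"
  shows "3 * length (filter P (result (medians_t (result (chop5_t xs))))) \<le> length (filter P xs) + 2"
proof -
  have short: "3 * length (filter P [result (median_t ys)]) \<le> length (filter P ys) + 2" if "ys \<noteq> []" for ys
    using assms[OF that] that by (cases "P (result (median_t ys))"; cases ys) simp_all
  show ?thesis
  proof (induction xs rule: chop5_t.induct)
    case (1 a b c d e xs)
    define ys where "ys = [a, b, c, d, e]"
    define m where "m = result (median_t ys)"
    have "P m \<Longrightarrow> 3 \<le> length (filter P ys)"
      using assms[of ys] by (simp add: m_def ys_def del: filter.simps)
    moreover have "length (filter P (a # b # c # d # e # xs)) = length (filter P ys) + length (filter P xs)"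
      unfolding ys_def by (simp flip: filter_append length_append del: filter.simps)
    moreover have "result (medians_t (result (chop5_t (a # b # c # d # e # xs)))) =
        m # result (medians_t (result (chop5_t xs)))"
      by (simp add: m_def ys_def)
    ultimately show ?case
      using 1 by (cases "P m") simp_all
  next
    case ("3_1" v)
    then show ?case using short[of "[v]"] by simp
  next
    case ("3_2" v va)
    then show ?case using short[of "[v, va]"] by simp
  next
    case ("3_3" v va vb)
    then show ?case using short[of "[v, va, vb]"] by simp
  next
    case ("3_4" v va vb vc)
    then show ?case using short[of "[v, va, vb, vc]"] by simp
  qed simp
qed

text \<open>For \<open>n = length xs > 20\<close>, the two recursive calls act on lists of total length at most
  \<open>29 / 30 * n\<close>, so that \<open>3600 * n\<close> absorbs the remaining linear work.\<close>

lemma cost_select_t_le: "cost (select_t k xs) \<le> 3600 * length xs + 500"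
proof (induction "length xs" arbitrary: k xs rule: less_induct)
  case less
  define n where "n = length xs"
  define ms where "ms = result (medians_t (result (chop5_t xs)))"
  define m where "m = length ms"
  define j where "j = (m - 1) div 2"
  define p where "p = result (select_t j ms)"
  define ls where "ls = filter (\<lambda>x. x < p) xs"
  define es where "es = filter (\<lambda>x. x = p) xs"
  define gs where "gs = filter (\<lambda>x. p < x) xs"
  have m: "m = (n + 4) div 5"
    by (simp add: m_def n_def ms_def result_medians_t length_chop5_t)
  show ?case
  proof (cases "n \<le> 20")
    case True
    \<comment> \<open>This case accounts for the additive 500: the total is at most
      \<open>1 + 21 + 441 + 21 = 484\<close>.\<close>
    have "(Suc n)\<^sup>2 \<le> 21\<^sup>2"
      using True by (intro power_mono) auto
    then have "cost (sort_t xs) \<le> 441"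
      using cost_sort_t_le[of xs] by (simp add: n_def)
    then show ?thesis
      using True cost_nth_t_le[of "sort xs" k] by (subst select_t.simps) (simp add: n_def)
  next
    case False
    have j: "j < length ms"
      using False m by (simp add: j_def m_def)
    have p: "p = sort ms ! j"
      using result_select_t[OF j] by (simp add: p_def)
    have med_le: "Suc j \<le> length (filter (\<lambda>x. x \<le> p) ms)"
      by (rule length_filter_le_nth_sort[OF j]) (simp add: p)
    have med_ge: "m - j \<le> length (filter (\<lambda>x. p \<le> x) ms)"
      unfolding m_def by (rule length_filter_ge_nth_sort[OF j]) (simp add: p)
    \<comment> \<open>At least \<open>j + 1\<close> of the medians are at most \<open>p\<close>;
      each stands for three elements of \<open>xs\<close>, up to the deficit of 2, and none of these
      elements lies in \<open>gs\<close>.\<close>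
    have "3 * Suc j \<le> length (filter (\<lambda>x. x \<le> p) xs) + 2"
      using medians_count[of "\<lambda>x. x \<le> p" xs] median_t_le_count med_le by (fastforce simp: ms_def)
    moreover have "length (filter (\<lambda>x. x \<le> p) xs) + length gs = n"
      using sum_length_filter_compl[of "\<lambda>x. x \<le> p" xs] by (simp add: gs_def n_def not_le)
    ultimately have gs: "length gs + 3 * Suc j \<le> n + 2"
      by linarith
    have "3 * (m - j) \<le> length (filter (\<lambda>x. p \<le> x) xs) + 2"
      using medians_count[of "\<lambda>x. p \<le> x" xs] median_t_ge_count med_ge by (fastforce simp: ms_def)
    moreover have "length (filter (\<lambda>x. p \<le> x) xs) + length ls = n"
      using sum_length_filter_compl[of "\<lambda>x. p \<le> x" xs] by (simp add: ls_def n_def not_le)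
    ultimately have ls: "length ls + 3 * (m - j) \<le> n + 2"
      by linarith
    have small: "30 * (m + length ls) \<le> 29 * n" "30 * (m + length gs) \<le> 29 * n"
    proof -
      have mn: "5 * m \<le> n + 4" "n \<le> 5 * m" and jm: "2 * j + 1 \<le> m" "m \<le> 2 * j + 2"
        using m False unfolding j_def by linarith+
      have "m + 1 \<le> 2 * (m - j)"
        using jm by linarith
      then show "30 * (m + length ls) \<le> 29 * n"
        using ls mn False unfolding add_mult_distrib2 by linarith
      \<comment> \<open>The pivot is the lower median, so this side has the weaker guarantee
        \<open>2 * (j + 1) \<ge> m\<close>. It yields
        \<open>m + length gs \<le> 9 / 10 * n + 2\<close>, which is below \<open>29 / 30 * n\<close>
        only from \<open>n = 30\<close> on. For \<open>n\<close> from 21 to 29 the exact values of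
        \<open>m\<close> and \<open>j\<close> are used.\<close>
      show "30 * (m + length gs) \<le> 29 * n"
      proof (cases "n \<ge> 30")
        case True
        then show ?thesis
          using gs mn(2) jm(2) by simp
      next
        case n: False
        then have "m = 5 \<or> m = 6"
          using mn False by linarith
        then have "j = 2"
          using jm by linarith
        with \<open>m = 5 \<or> m = 6\<close> show ?thesis
          using gs mn False n by auto
      qed
    qed
    have rec: "cost (select_t k' ys) \<le> 3600 * length ys + 500" if "length ys < n"
      for k' and ys :: "'a list"
      using less[of ys k'] that by (simp add: n_def)
    have ms: "cost (select_t j ms) \<le> 3600 * m + 500"
      using rec[of ms] small False by (simp add: m_def)
    have medians: "cost (medians_t (result (chop5_t xs))) \<le> Suc (50 * m)"
      using cost_medians_t_le[of "result (chop5_t xs)"] length_in_chop5_t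
      by (auto simp: m_def ms_def result_medians_t)
    have lens: "length ls \<le> n" "length es \<le> n"
      by (simp_all add: ls_def es_def n_def)
    \<comment> \<open>Cost of the final branch, of which at most one recursive call is
      executed.\<close>
    define last where "last =
      (if k < length ls then cost (select_t k ls)
       else if k < length ls + length es then 0
       else cost (select_t (k - length ls - length es) gs))"
    have last: "30 * (last + 3600 * m) \<le> 3600 * 29 * n + 30 * 500"
      using rec[of ls k] rec[of gs "k - length ls - length es"] small False
      by (auto simp: last_def)
    have "cost (select_t k xs) = 1 + Suc n + cost (chop5_t xs) +
        cost (medians_t (result (chop5_t xs))) + Suc m + cost (select_t j ms) + Suc n +
        Suc (length ls) + Suc (length es) + last"
      using False
      by (subst select_t.simps)
         (simp add: n_def result_partition3_t ls_def es_def gs_def p_def m_def ms_def j_def last_def)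
    \<comment> \<open>Shrinking to \<open>29 / 30 * n\<close> frees \<open>120 * n\<close>. Against
      it stand less than \<open>16 * n + 50\<close> units of other work and the additive 500 of the
      second recursive call, which fit since \<open>n > 20\<close>.\<close>
    also have "\<dots> \<le> 3600 * n + 500"
      using cost_chop5_t[of xs] medians ms lens last False m
      unfolding n_def[symmetric] add_mult_distrib2 by linarith
    finally show ?thesis
      by (simp add: n_def)
  qed
qed

section \<open>Potential argument for basic insertions\<close>

lemma cost_drop_max_t [simp]: "cost (drop_max_t m xs) = Suc (length xs)"
  by (induction xs arbitrary: m) auto

lemma cost_drop_min_t [simp]: "cost (drop_min_t m xs) = Suc (length xs)"
  by (induction xs arbitrary: m) auto

lemma cost_remove_max_t [simp]: "cost (remove_max_t xs) = Suc (length xs)"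
  by (cases xs) auto

lemma cost_remove_min_t [simp]: "cost (remove_min_t xs) = Suc (length xs)"
  by (cases xs) auto

text \<open>Besides correctness of the stored lengths, the bound \<open>l \<le> s\<close> is kept so
  that the two deletions from the Representative cost O(s).\<close>

definition sketch_inv :: "nat \<Rightarrow> state \<Rightarrow> bool" where
  "sketch_inv s = (\<lambda>(C, n, R, l). n = length C \<and> l = length R \<and> l \<le> s)"

text \<open>The share of a flush carried by one Candidate element: 7200 for two selections, 1008 for
  additive constants, and \<open>2 * (s div r) + 2\<close> for two passes over the Representative,
  where the 2 makes up for rounding in \<open>s div r\<close>.\<close>

definition credit :: "nat \<Rightarrow> nat \<Rightarrow> nat" where
  "credit r s = 8210 + 2 * (s div r)"

definition potential :: "nat \<Rightarrow> nat \<Rightarrow> state \<Rightarrow> nat" where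
  "potential r s = (\<lambda>(C, n, R, l). n * credit r s)"

lemma sketch_inv_empty_state [simp]: "sketch_inv s empty_state"
  by (simp add: sketch_inv_def empty_state_def)

lemma potential_empty_state [simp]: "potential r s empty_state = 0"
  by (simp add: potential_def empty_state_def)

text \<open>The credits of a full Candidate pay for a flush: two selections cost at most
  \<open>2 * (3600 * r + 500)\<close>, and the two deletions at most
  \<open>2 * s + 5\<close>.\<close>

lemma credit_ge:
  assumes "r > 0"
  shows "7200 * r + 1008 + 2 * s \<le> r * credit r s"
proof -
  have "s < r + r * (s div r)"
    using assms by (rule dividend_less_times_div)
  then have "2 * s \<le> r * (2 * (s div r) + 2)"
    by (simp add: algebra_simps)
  moreover have "1008 \<le> r * 1008"
    using assms by simp
  ultimately show ?thesis
    by (simp add: credit_def algebra_simps)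
qed

text \<open>An insertion that does not fill the Candidate deposits one credit. One that fills it
  releases the \<open>r - 1\<close> stored credits, and together with its own credit these cover the
  flush. The extra 1 is the call itself.\<close>

lemma basic_insert_t_amortized:
  assumes "r > 0" "sketch_inv s S"
  shows "sketch_inv s (result (basic_insert_t r s x S))"
    and "cost (basic_insert_t r s x S) + potential r s (result (basic_insert_t r s x S))
      \<le> potential r s S + credit r s + 1"
proof -
  obtain C n R l where S: "S = (C, n, R, l)"
    by (cases S)
  with assms(2) have [simp]: "n = length C" "l = length R" and l: "length R \<le> s"
    by (auto simp: sketch_inv_def)
  show "sketch_inv s (result (basic_insert_t r s x S))"
    using l by (simp add: S basic_insert_t_def sketch_inv_def length_remove_max_t length_remove_min_t
        del: remove_max_t.simps remove_min_t.simps)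
  show "cost (basic_insert_t r s x S) + potential r s (result (basic_insert_t r s x S))
      \<le> potential r s S + credit r s + 1"
  proof (cases "Suc (length C) = r")
    case True
    \<comment> \<open>The overflow branch is the expensive one; its deletions scan lists of lengths
      \<open>length R + 2\<close> and \<open>length R + 1\<close>.\<close>
    have "cost (basic_insert_t r s x S) \<le>
        1 + cost (select_t (r div 2 - 1) (x # C)) + cost (select_t (r div 2) (x # C))
        + (length R + 3) + (length R + 2)"
      using True by (simp add: S basic_insert_t_def length_remove_max_t
          del: remove_max_t.simps remove_min_t.simps)
    also have "\<dots> \<le> 1 + (7200 * r + 1008 + 2 * s)"
      using cost_select_t_le[of "r div 2 - 1" "x # C"] cost_select_t_le[of "r div 2" "x # C"] True l
      by simp
    also have "\<dots> \<le> 1 + r * credit r s"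
      using credit_ge[OF assms(1), of s] by simp
    also have "r * credit r s = length C * credit r s + credit r s"
      by (simp flip: True)
    finally have "cost (basic_insert_t r s x S) \<le> 1 + (length C * credit r s + credit r s)" .
    moreover have "potential r s (result (basic_insert_t r s x S)) = 0"
      using True by (simp add: S basic_insert_t_def potential_def)
    ultimately show ?thesis
      by (simp add: S potential_def)
  next
    case False
    then show ?thesis
      by (simp add: S basic_insert_t_def potential_def)
  qed
qed

text \<open>Each copy needs its credit, one unit for the basic insertion and one for the loop; the
  final 1 is the terminating call.\<close>

lemma insert_copies_t_amortized:
  assumes "r > 0" "sketch_inv s S"
  shows "sketch_inv s (result (insert_copies_t r s x j S)) \<and>
    cost (insert_copies_t r s x j S) + potential r s (result (insert_copies_t r s x j S))
      \<le> potential r s S + j * (credit r s + 2) + 1"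
  using assms(2)
proof (induction j arbitrary: S)
  case (Suc j)
  define S' where "S' = result (basic_insert_t r s x S)"
  note step = basic_insert_t_amortized[OF assms(1) Suc.prems, of x, folded S'_def]
  from Suc.IH[OF step(1)] step(2) show ?case
    by (simp add: S'_def[symmetric])
qed simp

section \<open>The mean number of basic insertions per item\<close>

lemma draws_ge_1: "z \<in> set_pmf (draws w) \<Longrightarrow> 1 \<le> z"
  by (auto simp: draws_def split: if_splits)

text \<open>\<open>geometric_pmf p\<close> counts failures and has mean \<open>(1 - p) / p\<close>;
  counting the success as well adds 1.\<close>

lemma nn_integral_Suc_geometric_pmf:
  assumes "0 < p" "p \<le> 1"
  shows "(\<integral>\<^sup>+ z. of_nat z \<partial>measure_pmf (map_pmf Suc (geometric_pmf p))) = ennreal (1 / p)"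
proof -
  have p: "p \<in> {0<..1}"
    using assms by simp
  have "nn_integral (measure_pmf (geometric_pmf p)) of_nat =
      (\<integral>\<^sup>+ z. ennreal (real z) \<partial>measure_pmf (geometric_pmf p))"
    by (intro nn_integral_cong) (simp add: ennreal_of_nat_eq_real_of_nat)
  also have "\<dots> = ennreal ((1 - p) / p)"
    using nn_integral_eq_integral[OF integrable_real_geometric_pmf[OF p]] expectation_geometric_pmf[OF p]
    by simp
  finally have "nn_integral (measure_pmf (geometric_pmf p)) of_nat = ennreal ((1 - p) / p)" .
  then have "(\<integral>\<^sup>+ z. of_nat z \<partial>measure_pmf (map_pmf Suc (geometric_pmf p))) =
      1 + ennreal ((1 - p) / p)"
    by (simp add: nn_integral_add)
  also have "\<dots> = ennreal (1 + (1 - p) / p)"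
    using assms by (simp add: ennreal_plus flip: ennreal_1)
  also have "1 + (1 - p) / p = 1 / p"
    using assms by (simp add: field_simps)
  finally show ?thesis .
qed

text \<open>The mean is \<open>2 * w\<close>, \<open>2 - 2 * w\<close> or 1 in the three cases,
  hence bounded uniformly in \<open>w\<close>.\<close>

lemma expectation_draws_le:
  assumes "0 < w" "w < 1"
  shows "(\<integral>\<^sup>+ z. of_nat z \<partial>measure_pmf (draws w)) \<le> 2"
proof -
  have two: "ennreal x \<le> 2" if "x \<le> 2" for x
    using ennreal_leI[OF that] by simp
  consider "w > 1 / 2" | "w < 1 / 2" | "w = 1 / 2"
    by linarith
  then show ?thesis
  proof cases
    case 1
    then show ?thesis
      using nn_integral_Suc_geometric_pmf[of "1 / (2 * w)"] assms two[of "2 * w"]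
      by (simp add: draws_def del: nn_integral_map_pmf)
  next
    case 2
    then show ?thesis
      using nn_integral_Suc_geometric_pmf[of "1 / (2 - 2 * w)"] assms two[of "2 - 2 * w"]
      by (simp add: draws_def del: nn_integral_map_pmf)
  next
    case 3
    then show ?thesis
      by (simp add: draws_def)
  qed
qed

section \<open>Expected cost of items and of streams\<close>

text \<open>For a fixed outcome \<open>z\<close>, cost plus change of potential is at most affine in
  \<open>z\<close>, so only the mean of \<open>z\<close> matters. With mean at most 2 the bound is
  \<open>1 + 2 * (credit r s + 3)\<close>.\<close>

lemma insert_item_t_amortized:
  assumes "r > 0" "sketch_inv s S"
  shows "t \<in> set_pmf (insert_item_t w r s e S) \<Longrightarrow> sketch_inv s (result t)"
    and "0 < w \<Longrightarrow> w < 1 \<Longrightarrow>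
      (\<integral>\<^sup>+ t. of_nat (cost t + potential r s (result t)) \<partial>measure_pmf (insert_item_t w r s e S))
        \<le> of_nat (potential r s S + (2 * credit r s + 7))"
proof -
  define item where "item = (\<lambda>z. tick (do {
      charge z;
      S' \<leftarrow> insert_copies_t r s (padding w) (z - 1) S;
      basic_insert_t r s (ereal (snd e)) S' }))"
  have item_t: "insert_item_t w r s e S = map_pmf item (draws w)"
    by (simp add: insert_item_t_def item_def)
  \<comment> \<open>Every basic insertion comes with three units: its draw, its own call, and one
    call of the copying loop, where the terminating call is assigned to the item's value. The
    additional 1 is the call for the item.\<close>
  have *: "sketch_inv s (result (item z)) \<and> cost (item z) + potential r s (result (item z))
      \<le> potential r s S + 1 + z * (credit r s + 3)" if z_in: "z \<in> set_pmf (draws w)" for z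
  proof -
    obtain j where z: "z = Suc j"
      using draws_ge_1[OF z_in] by (cases z) auto
    define S' where "S' = result (insert_copies_t r s (padding w) j S)"
    have S': "sketch_inv s S'" "cost (insert_copies_t r s (padding w) j S) + potential r s S'
        \<le> potential r s S + j * (credit r s + 2) + 1"
      using insert_copies_t_amortized[OF assms, of "padding w" j] by (simp_all add: S'_def)
    show ?thesis
      using S'(2) basic_insert_t_amortized[OF assms(1) S'(1), of "ereal (snd e)"]
      by (simp add: item_def z S'_def[symmetric] algebra_simps)
  qed
  then show "t \<in> set_pmf (insert_item_t w r s e S) \<Longrightarrow> sketch_inv s (result t)"
    by (auto simp: item_t)
  assume w: "0 < w" "w < 1"
  have "(\<integral>\<^sup>+ t. of_nat (cost t + potential r s (result t)) \<partial>measure_pmf (insert_item_t w r s e S))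
      = (\<integral>\<^sup>+ z. of_nat (cost (item z) + potential r s (result (item z))) \<partial>measure_pmf (draws w))"
    by (simp add: item_t)
  also have "\<dots> \<le> (\<integral>\<^sup>+ z. of_nat (potential r s S + 1) + of_nat (credit r s + 3) * of_nat z
      \<partial>measure_pmf (draws w))"
  proof (rule nn_integral_mono_AE, rule AE_pmfI)
    fix z assume "z \<in> set_pmf (draws w)"
    then have "cost (item z) + potential r s (result (item z))
        \<le> potential r s S + 1 + (credit r s + 3) * z"
      using * by (simp add: mult.commute)
    then show "(of_nat (cost (item z) + potential r s (result (item z))) :: ennreal)
        \<le> of_nat (potential r s S + 1) + of_nat (credit r s + 3) * of_nat z"
      unfolding of_nat_mult[symmetric] of_nat_add[symmetric] of_nat_le_iff .
  qed
  also have "\<dots> = of_nat (potential r s S + 1)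
      + of_nat (credit r s + 3) * (\<integral>\<^sup>+ z. of_nat z \<partial>measure_pmf (draws w))"
    by (subst nn_integral_add) (simp_all add: nn_integral_cmult)
  also have "\<dots> \<le> of_nat (potential r s S + 1) + of_nat (credit r s + 3) * of_nat 2"
    using expectation_draws_le[OF w] by (intro add_left_mono mult_left_mono) auto
  also have "\<dots> = of_nat (potential r s S + (2 * credit r s + 7))"
    unfolding of_nat_mult[symmetric] of_nat_add[symmetric] by (simp add: algebra_simps)
  finally show "(\<integral>\<^sup>+ t. of_nat (cost t + potential r s (result t))
      \<partial>measure_pmf (insert_item_t w r s e S)) \<le> of_nat (potential r s S + (2 * credit r s + 7))" .
qed

text \<open>The potentials telescope in expectation: conditioned on the outcome of the first item,
  the induction hypothesis charges the remaining stream to the potential that this outcome leaves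
  behind, so the start state is kept arbitrary.\<close>

lemma insert_stream_t_amortized:
  assumes "0 < w" "w < 1" "r > 0" "sketch_inv s S"
  shows "(\<integral>\<^sup>+ t. of_nat (cost t) \<partial>measure_pmf (insert_stream_t w r s es S))
      \<le> of_nat (potential r s S + length es * (2 * credit r s + 7))"
  using assms(4)
proof (induction es arbitrary: S)
  case (Cons e es)
  define B where "B = 2 * credit r s + 7"
  have "(\<integral>\<^sup>+ t. of_nat (cost t) \<partial>measure_pmf (insert_stream_t w r s (e # es) S))
      = (\<integral>\<^sup>+ u. of_nat (cost u)
          + (\<integral>\<^sup>+ t. of_nat (cost t) \<partial>measure_pmf (insert_stream_t w r s es (result u)))
          \<partial>measure_pmf (insert_item_t w r s e S))"
    by (simp add: nn_integral_add)
  \<comment> \<open>The potential supplied by the induction hypothesis joins the cost of the first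
    item, which gives the integrand of the bound for a single item.\<close>
  also have "\<dots> \<le> (\<integral>\<^sup>+ u. of_nat (cost u + potential r s (result u)) + of_nat (length es * B)
      \<partial>measure_pmf (insert_item_t w r s e S))"
  proof (rule nn_integral_mono_AE, rule AE_pmfI)
    fix u assume "u \<in> set_pmf (insert_item_t w r s e S)"
    from Cons.IH[OF insert_item_t_amortized(1)[OF assms(3) Cons.prems this]]
    show "of_nat (cost u)
          + (\<integral>\<^sup>+ t. of_nat (cost t) \<partial>measure_pmf (insert_stream_t w r s es (result u)))
        \<le> (of_nat (cost u + potential r s (result u)) + of_nat (length es * B) :: ennreal)"
      unfolding B_def[symmetric] of_nat_add add.assoc by (rule add_left_mono)
  qed
  also have "\<dots> = (\<integral>\<^sup>+ u. of_nat (cost u + potential r s (result u))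
      \<partial>measure_pmf (insert_item_t w r s e S)) + of_nat (length es * B)"
    by (subst nn_integral_add) simp_all
  also have "\<dots> \<le> of_nat (potential r s S + B) + of_nat (length es * B)"
    using insert_item_t_amortized(2)[OF assms(3) Cons.prems assms(1,2), of e]
    unfolding B_def by (rule add_right_mono)
  also have "\<dots> = of_nat (potential r s S + length (e # es) * B)"
    unfolding of_nat_add[symmetric] by (simp add: algebra_simps)
  finally show ?case
    by (simp only: B_def)
qed (simp add: ret_def)

text \<open>The empty state has potential 0, so the stream bound is \<open>length es\<close> times a
  bound per item, and the length cancels.\<close>

lemma expected_amortized_time_le:
  assumes "0 < w" "w < 1" "r > 0" "es \<noteq> []"
  shows "expected_amortized_time w r s es \<le> ennreal (real (2 * credit r s + 7))"
proof -
  define B where "B = 2 * credit r s + 7"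
  have "expected_amortized_time w r s es =
      (\<integral>\<^sup>+ t. ennreal (1 / real (length es)) * of_nat (cost t)
        \<partial>measure_pmf (insert_stream_t w r s es empty_state))"
    unfolding expected_amortized_time_def
    by (simp add: ennreal_of_nat_eq_real_of_nat flip: ennreal_mult)
  also have "\<dots> = ennreal (1 / real (length es)) *
      (\<integral>\<^sup>+ t. of_nat (cost t) \<partial>measure_pmf (insert_stream_t w r s es empty_state))"
    by (simp add: nn_integral_cmult)
  also have "\<dots> \<le> ennreal (1 / real (length es)) * of_nat (length es * B)"
    using insert_stream_t_amortized[OF assms(1-3) sketch_inv_empty_state, of s es]
    by (intro mult_left_mono) (simp_all add: B_def)
  also have "\<dots> = ennreal (real B)"
    using assms(4)
    by (simp add: ennreal_of_nat_eq_real_of_nat del: of_nat_mult flip: ennreal_mult) simp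
  finally show ?thesis
    by (simp add: B_def)
qed

theorem theorem6:
  fixes w :: real
  assumes "0 < w" and "w < 1"
  shows "\<exists>K > 0. \<forall>r s. even r \<and> r > 0 \<and> even s \<and> s > 0 \<longrightarrow>
    (\<forall>es :: ('k \<times> real) list. es \<noteq> [] \<longrightarrow>
       expected_amortized_time w r s es \<le> ennreal (K * max 1 (real s / real r)))"
proof (intro exI[of _ 16431] conjI allI impI)
  fix r s :: nat and es :: "('k \<times> real) list"
  assume rs: "even r \<and> r > 0 \<and> even s \<and> s > 0" and es: "es \<noteq> []"
  \<comment> \<open>The witness is \<open>16431 = 2 * 8210 + 7 + 4\<close>: the constant part 16427
    is absorbed by the 1 in the maximum, and the remaining \<open>4 * (s div r)\<close> by the
    ratio.\<close>
  have "real (s div r) \<le> real s / real r"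
    by (rule of_nat_div_le_of_nat)
  then have "real (2 * credit r s + 7) \<le> 16431 * max 1 (real s / real r)"
    by (simp add: credit_def max_def)
  then show "expected_amortized_time w r s es \<le> ennreal (16431 * max 1 (real s / real r))"
    using expected_amortized_time_le[OF assms _ es, of r s] rs
    by (meson ennreal_leI order_trans)
qed simp

end
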